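(* Let $v\ge 4$ be an integer with $v\not\equiv 2\pmod 4$. Then there exists an AOA$(1,3,5,v)$.
   Context: An orthogonal array OA$(t,k,v)$ (with $1\le t\le k$) is a $v^t\times k$ array with entries from a set $X$ of size $v$ such that, for every choice of $t$ of its columns, each $t$-tuple in $X^t$ appears exactly once as a row of the corresponding $v^t\times t$ subarray. For integers $1\le s\le t\le k$, an augmented orthogonal array AOA$(s,t,k,v)$ is a $v^t\times(k+1)$ array $A$ such that: (1) the first $k$ columns of $A$ form an OA$(t,k,v)$ on a symbol set $X$ of size $v$; (2) the last column of $A$ has entries from a set $Y$ of size $v^{t-s}$; (3) for any choice of $s$ of the first $k$ columns, these $s$ columns together with the last column contain every $(s+1)$-tuple of $X^s\times Y$ exactly once as a row. *)

theory Defs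
  imports Main "HOL-Library.FuncSet"
begin

text \<open>An array with N rows and k columns is represented by a function
  A :: nat => nat => 'a, where A i j is the entry in row i (i < N) and
  column j (j < k).  Rows are indexed, so repeated rows count separately.\<close>

definition is_OA :: "nat \<Rightarrow> nat \<Rightarrow> nat \<Rightarrow> 'a set \<Rightarrow> (nat \<Rightarrow> nat \<Rightarrow> 'a) \<Rightarrow> bool" where
  "is_OA t k v X A \<longleftrightarrow>
     1 \<le> t \<and> t \<le> k \<and> finite X \<and> card X = v \<and>
     (\<forall>i < v ^ t. \<forall>j < k. A i j \<in> X) \<and>
     (\<forall>C. C \<subseteq> {..<k} \<longrightarrow> card C = t \<longrightarrow>
        (\<forall>f \<in> C \<rightarrow>\<^sub>E X. card {i. i < v ^ t \<and> (\<forall>j \<in> C. A i j = f j)} = 1))"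

text \<open>AOA(s,t,k,v): a v^t x (k+1) array; the first k columns are given by A,
  the last column by L.\<close>
definition is_AOA :: "nat \<Rightarrow> nat \<Rightarrow> nat \<Rightarrow> nat \<Rightarrow> 'a set \<Rightarrow> 'b set
                       \<Rightarrow> (nat \<Rightarrow> nat \<Rightarrow> 'a) \<Rightarrow> (nat \<Rightarrow> 'b) \<Rightarrow> bool" where
  "is_AOA s t k v X Y A L \<longleftrightarrow>
     1 \<le> s \<and> s \<le> t \<and> t \<le> k \<and>
     is_OA t k v X A \<and>
     finite Y \<and> card Y = v ^ (t - s) \<and>
     (\<forall>i < v ^ t. L i \<in> Y) \<and>
     (\<forall>C. C \<subseteq> {..<k} \<longrightarrow> card C = s \<longrightarrow>
        (\<forall>f \<in> C \<rightarrow>\<^sub>E X. \<forall>y \<in> Y.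
           card {i. i < v ^ t \<and> (\<forall>j \<in> C. A i j = f j) \<and> L i = y} = 1))"

definition AOA_exists :: "nat \<Rightarrow> nat \<Rightarrow> nat \<Rightarrow> nat \<Rightarrow> bool" where
  "AOA_exists s t k v \<longleftrightarrow>
     (\<exists>(X :: nat set) (Y :: nat set) A L. is_AOA s t k v X Y A L)"

end

theory Submission
  imports Defs "HOL-Library.Product_Plus" "HOL-Computational_Algebra.Primes"
begin

text \<open>
  Let \<open>G\<close> be an abelian group of order \<open>v\<close> with two orthogonal orthomorphisms, i.e. maps \<open>\<alpha>\<close>, \<open>\<beta>\<close>
  such that all pairwise differences of \<open>0, id, \<alpha>, \<beta>\<close> are bijective. Then the rows
  \<open>(a, s + a, \<alpha> s + i + a, \<beta> s + i + a, i)\<close> form an orthogonal array of strength 3, and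
  \<open>(s, i + \<alpha> a)\<close> is a valid last column. Since augmented orthogonal arrays multiply, only the orders
  4, 8, 9, 12, 24, 27, \<open>w\<close> and \<open>3w\<close> with \<open>w\<close> coprime to 6 are needed. For \<open>w\<close> the maps \<open>2x\<close> and \<open>3x\<close>
  on \<open>\<int>\<^sub>w\<close> will do.

  For \<open>3w\<close> no linear maps exist. On \<open>\<int>\<^sub>3 \<times> \<int>\<^sub>w\<close> take \<open>\<alpha> (a, x) = (c x - a, -3x)\<close> and
  \<open>\<beta> (a, x) = (B a x, -x - 2 t a)\<close> with \<open>t 0 = 0\<close>, \<open>t 1 = 1\<close>, \<open>t 2 = -1\<close>. Because the slopes of all
  differences are units and divide the shifts, orthogonality becomes a condition on windows of length
  5 of the cyclic word of length \<open>w\<close> with letters \<open>(B 0 x, B 1 x, B 2 x, c x)\<close>. Such words exist for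
  all \<open>w \<ge> 5\<close> not divisible by 3: a defect of length 4 or 5 followed by repetitions of one block of length 3.
\<close>

section \<open>Arrays as families of rows\<close>

text \<open>Only uniqueness of rows is demanded; the prescribed sizes of \<open>R\<close> and
  \<open>Y\<close> then force existence. Rows and symbols may have any type, so groups and products
  can be used directly.\<close>

definition aoa_family ::
  "nat \<Rightarrow> nat \<Rightarrow> nat \<Rightarrow> 'a set \<Rightarrow> 'b set \<Rightarrow> 'r set \<Rightarrow> ('r \<Rightarrow> nat \<Rightarrow> 'a) \<Rightarrow> ('r \<Rightarrow> 'b) \<Rightarrow> bool" where
  "aoa_family s t k X Y R A L \<longleftrightarrow>
     1 \<le> s \<and> s \<le> t \<and> t \<le> k \<and> finite X \<and> finite Y \<and> finite R \<and>
     card Y = card X ^ (t - s) \<and> card R = card X ^ t \<and>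
     (\<forall>r\<in>R. (\<forall>j<k. A r j \<in> X) \<and> L r \<in> Y) \<and>
     (\<forall>C\<subseteq>{..<k}. card C = t \<longrightarrow>
        (\<forall>r\<in>R. \<forall>r'\<in>R. (\<forall>j\<in>C. A r j = A r' j) \<longrightarrow> r = r')) \<and>
     (\<forall>C\<subseteq>{..<k}. card C = s \<longrightarrow>
        (\<forall>r\<in>R. \<forall>r'\<in>R. (\<forall>j\<in>C. A r j = A r' j) \<and> L r = L r' \<longrightarrow> r = r'))"

lemma aoa_familyD:
  assumes "aoa_family s t k X Y R A L"
  shows "1 \<le> s" "s \<le> t" "t \<le> k" "finite X" "finite Y" "finite R"
    and "card Y = card X ^ (t - s)" "card R = card X ^ t"
    and "r \<in> R \<Longrightarrow> j < k \<Longrightarrow> A r j \<in> X" "r \<in> R \<Longrightarrow> L r \<in> Y"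
    and "\<lbrakk>C \<subseteq> {..<k}; card C = t; r \<in> R; r' \<in> R; \<And>j. j \<in> C \<Longrightarrow> A r j = A r' j\<rbrakk> \<Longrightarrow> r = r'"
    and "\<lbrakk>C \<subseteq> {..<k}; card C = s; r \<in> R; r' \<in> R; \<And>j. j \<in> C \<Longrightarrow> A r j = A r' j; L r = L r'\<rbrakk> \<Longrightarrow> r = r'"
  using assms by (simp_all add: aoa_family_def)

text \<open>Pigeonhole: an injection between finite sets of equal size is onto.\<close>

lemma card_fibre_eq_1:
  assumes "inj_on g I" "g ` I \<subseteq> F" "finite F" "card I = card F" "f \<in> F"
  shows "card {i \<in> I. g i = f} = 1"
proof -
  have "g ` I = F"
    using assms by (metis card_image card_subset_eq)
  then obtain i where "i \<in> I" "g i = f"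
    using assms by blast
  then have "{i \<in> I. g i = f} = {i}"
    using assms(1) by (auto dest: inj_onD)
  then show ?thesis by simp
qed

lemma restrict_eqD: "restrict f C = restrict g C \<Longrightarrow> j \<in> C \<Longrightarrow> f j = g j"
  by (metis restrict_apply')

lemma restrict_eq_iff:
  assumes "f \<in> C \<rightarrow>\<^sub>E X"
  shows "restrict g C = f \<longleftrightarrow> (\<forall>j\<in>C. g j = f j)"
  using PiE_restrict[OF assms] by (metis restrict_apply' restrict_ext)

text \<open>Counting: there are as many rows as \<open>t\<close>-tuples, and also as many as pairs
  of an \<open>s\<close>-tuple and a symbol of \<open>Y\<close>, since
  \<open>card X ^ s * card X ^ (t - s) = card X ^ t\<close>.\<close>

lemma is_AOA_if_aoa_family:
  assumes "aoa_family s t k X Y {..<card X ^ t} A L"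
  shows "is_AOA s t k (card X) X Y A L"
proof -
  let ?I = "{..<card X ^ t}"
  note fam = aoa_familyD[OF assms]
  have "card {i. i < card X ^ t \<and> (\<forall>j\<in>C. A i j = f j)} = 1"
    if C: "C \<subseteq> {..<k}" "card C = t" and f: "f \<in> C \<rightarrow>\<^sub>E X" for C f
  proof -
    have finC: "finite C" using C finite_subset by auto
    have "card {i \<in> ?I. restrict (A i) C = f} = 1"
    proof (rule card_fibre_eq_1)
      show "inj_on (\<lambda>i. restrict (A i) C) ?I"
        by (intro inj_onI fam(11)[OF C]) (auto dest: restrict_eqD)
      show "(\<lambda>i. restrict (A i) C) ` ?I \<subseteq> C \<rightarrow>\<^sub>E X"
        using fam(9) C by auto
      show "finite (C \<rightarrow>\<^sub>E X)" using finC fam(4,5) by (simp add: finite_PiE)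
      show "card ?I = card (C \<rightarrow>\<^sub>E X)" using finC C by (simp add: card_PiE)
    qed (use f in auto)
    also have "{i \<in> ?I. restrict (A i) C = f} = {i. i < card X ^ t \<and> (\<forall>j\<in>C. A i j = f j)}"
      using restrict_eq_iff[OF f] by auto
    finally show ?thesis .
  qed
  moreover have "card {i. i < card X ^ t \<and> (\<forall>j\<in>C. A i j = f j) \<and> L i = y} = 1"
    if C: "C \<subseteq> {..<k}" "card C = s" and f: "f \<in> C \<rightarrow>\<^sub>E X" and y: "y \<in> Y" for C f y
  proof -
    have finC: "finite C" using C finite_subset by auto
    have "card {i \<in> ?I. (restrict (A i) C, L i) = (f, y)} = 1"
    proof (rule card_fibre_eq_1)
      show "inj_on (\<lambda>i. (restrict (A i) C, L i)) ?I"
        by (intro inj_onI fam(12)[OF C]) (auto dest: restrict_eqD)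
      show "(\<lambda>i. (restrict (A i) C, L i)) ` ?I \<subseteq> (C \<rightarrow>\<^sub>E X) \<times> Y"
        using fam(9,10) C by auto
      show "finite ((C \<rightarrow>\<^sub>E X) \<times> Y)" using finC fam(4,5) by (simp add: finite_PiE)
      have "card X ^ s * card X ^ (t - s) = card X ^ t"
        using fam(2) by (simp flip: power_add)
      then show "card ?I = card ((C \<rightarrow>\<^sub>E X) \<times> Y)"
        using finC C fam(7) by (simp add: card_PiE card_cartesian_product)
    qed (use f y in auto)
    also have "{i \<in> ?I. (restrict (A i) C, L i) = (f, y)}
        = {i. i < card X ^ t \<and> (\<forall>j\<in>C. A i j = f j) \<and> L i = y}"
      using restrict_eq_iff[OF f] by auto
    finally show ?thesis .
  qed
  ultimately show ?thesis
    unfolding is_AOA_def is_OA_def using fam(1-5,7,9,10) by simp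
qed

lemma aoa_family_if_is_AOA:
  assumes "is_AOA s t k v X Y A L"
  shows "aoa_family s t k X Y {..<v ^ t} A L" "card X = v"
proof -
  have OA: "is_OA t k v X A" and AOA: "1 \<le> s" "s \<le> t" "t \<le> k" "finite Y" "card Y = v ^ (t - s)"
    and L: "\<And>i. i < v ^ t \<Longrightarrow> L i \<in> Y"
    and s: "\<And>C f y. \<lbrakk>C \<subseteq> {..<k}; card C = s; f \<in> C \<rightarrow>\<^sub>E X; y \<in> Y\<rbrakk> \<Longrightarrow>
         card {i. i < v ^ t \<and> (\<forall>j \<in> C. A i j = f j) \<and> L i = y} = 1"
    using assms by (simp_all add: is_AOA_def)
  have X: "finite X" "card X = v" and A: "\<And>i j. i < v ^ t \<Longrightarrow> j < k \<Longrightarrow> A i j \<in> X"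
    and t: "\<And>C f. \<lbrakk>C \<subseteq> {..<k}; card C = t; f \<in> C \<rightarrow>\<^sub>E X\<rbrakk> \<Longrightarrow>
         card {i. i < v ^ t \<and> (\<forall>j \<in> C. A i j = f j)} = 1"
    using OA by (simp_all add: is_OA_def)
  have inj_t: "i = i'" if C: "C \<subseteq> {..<k}" "card C = t" and i: "i < v ^ t" "i' < v ^ t"
    and eq: "\<forall>j\<in>C. A i j = A i' j" for C i i'
  proof -
    \<comment> \<open>The prescribed tuple is row \<open>i\<close> itself; \<open>restrict\<close>
      makes it a member of \<open>C \<rightarrow>\<^sub>E X\<close>.\<close>
    let ?S = "{l. l < v ^ t \<and> (\<forall>j \<in> C. A l j = restrict (A i) C j)}"
    have "card ?S = 1" using C A[OF i(1)] by (intro t) auto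
    then obtain l where "?S = {l}" by (rule card_1_singletonE)
    moreover have "i \<in> ?S" "i' \<in> ?S" using i eq by auto
    ultimately show ?thesis by (metis singletonD)
  qed
  have inj_s: "i = i'" if C: "C \<subseteq> {..<k}" "card C = s" and i: "i < v ^ t" "i' < v ^ t"
    and eq: "\<forall>j\<in>C. A i j = A i' j" "L i = L i'" for C i i'
  proof -
    let ?S = "{l. l < v ^ t \<and> (\<forall>j \<in> C. A l j = restrict (A i) C j) \<and> L l = L i}"
    have "card ?S = 1" using C A[OF i(1)] L[OF i(1)] by (intro s) auto
    then obtain l where "?S = {l}" by (rule card_1_singletonE)
    moreover have "i \<in> ?S" "i' \<in> ?S" using i eq by auto
    ultimately show ?thesis by (metis singletonD)
  qed
  show "aoa_family s t k X Y {..<v ^ t} A L"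
    unfolding aoa_family_def
  proof (intro conjI ballI allI impI)
    fix C i i'
    assume "C \<subseteq> {..<k}" "card C = t" "i \<in> {..<v ^ t}" "i' \<in> {..<v ^ t}" "\<forall>j\<in>C. A i j = A i' j"
    then show "i = i'" by (intro inj_t[of C i i']) simp_all
  next
    fix C i i'
    assume "C \<subseteq> {..<k}" "card C = s" "i \<in> {..<v ^ t}" "i' \<in> {..<v ^ t}"
      "(\<forall>j\<in>C. A i j = A i' j) \<and> L i = L i'"
    then show "i = i'" by (intro inj_s[of C i i']) simp_all
  qed (use AOA X A L in simp_all)
  show "card X = v" by (fact X(2))
qed

text \<open>Uniqueness of rows survives an injective renaming of symbols and an enumeration of the
  rows, so every family can be moved to natural numbers.\<close>

lemma AOA_exists_if_aoa_family:
  assumes "aoa_family s t k X Y R A L"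
  shows "AOA_exists s t k (card X)"
proof -
  note fam = aoa_familyD[OF assms]
  obtain f :: "'a \<Rightarrow> nat" where f: "inj_on f X"
    using finite_imp_inj_to_nat_seg[OF fam(4)] by blast
  obtain g :: "'b \<Rightarrow> nat" where g: "inj_on g Y"
    using finite_imp_inj_to_nat_seg[OF fam(5)] by blast
  obtain h where h: "bij_betw h {..<card X ^ t} R"
    using ex_bij_betw_nat_finite[OF fam(6)] fam(8) by (auto simp: atLeast0LessThan)
  have fX: "card (f ` X) = card X" by (simp add: card_image f)
  have gY: "card (g ` Y) = card Y" by (simp add: card_image g)
  have hR: "\<And>i. i < card X ^ t \<Longrightarrow> h i \<in> R" using h by (auto dest: bij_betwE)
  have hinj: "\<And>i i'. \<lbrakk>i < card X ^ t; i' < card X ^ t; h i = h i'\<rbrakk> \<Longrightarrow> i = i'"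
    using h by (auto simp: bij_betw_def dest: inj_onD)
  have eq: "A r j = A r' j" if "f (A r j) = f (A r' j)" "r \<in> R" "r' \<in> R" "j < k" for r r' j
    using that f fam(9) by (meson inj_onD)
  have "aoa_family s t k (f ` X) (g ` Y) {..<card X ^ t} (\<lambda>i j. f (A (h i) j)) (\<lambda>i. g (L (h i)))"
    unfolding aoa_family_def fX gY
  proof (intro conjI ballI allI impI)
    fix C i i'
    assume C: "C \<subseteq> {..<k}" "card C = t" and i: "i \<in> {..<card X ^ t}" "i' \<in> {..<card X ^ t}"
      and "\<forall>j\<in>C. f (A (h i) j) = f (A (h i') j)"
    then have "\<forall>j\<in>C. A (h i) j = A (h i') j"
      using hR eq by (meson lessThan_iff subsetD)
    then show "i = i'" using fam(11)[OF C] hR hinj i by (metis lessThan_iff)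
  next
    fix C i i'
    assume C: "C \<subseteq> {..<k}" "card C = s" and i: "i \<in> {..<card X ^ t}" "i' \<in> {..<card X ^ t}"
      and e: "(\<forall>j\<in>C. f (A (h i) j) = f (A (h i') j)) \<and> g (L (h i)) = g (L (h i'))"
    then have "\<forall>j\<in>C. A (h i) j = A (h i') j"
      using hR eq by (meson lessThan_iff subsetD)
    moreover have "L (h i) = L (h i')" using e i g fam(10) hR by (meson inj_onD lessThan_iff)
    ultimately show "i = i'" using fam(12)[OF C] hR hinj i by (metis lessThan_iff)
  qed (use fam(1-10) hR in auto)
  then show ?thesis
    unfolding AOA_exists_def using is_AOA_if_aoa_family fX by metis
qed

text \<open>Direct product: two rows agree in a column iff both of their components do, so
  uniqueness is inherited from the factors.\<close>

lemma AOA_exists_mult: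
  assumes "AOA_exists s t k m" "AOA_exists s t k n"
  shows "AOA_exists s t k (m * n)"
proof -
  obtain X Y :: "nat set" and A L where m: "is_AOA s t k m X Y A L"
    using assms(1) by (auto simp: AOA_exists_def)
  obtain X' Y' :: "nat set" and A' L' where n: "is_AOA s t k n X' Y' A' L'"
    using assms(2) by (auto simp: AOA_exists_def)
  note m = aoa_family_if_is_AOA[OF m] and n = aoa_family_if_is_AOA[OF n]
  have "aoa_family s t k (X \<times> X') (Y \<times> Y') ({..<m ^ t} \<times> {..<n ^ t})
     (\<lambda>(i, i') j. (A i j, A' i' j)) (\<lambda>(i, i'). (L i, L' i'))"
    unfolding aoa_family_def
  proof (intro conjI ballI allI impI)
    fix C r r'
    assume C: "C \<subseteq> {..<k}" "card C = t" and r: "r \<in> {..<m ^ t} \<times> {..<n ^ t}" "r' \<in> {..<m ^ t} \<times> {..<n ^ t}"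
      and e: "\<forall>j\<in>C. (case r of (i, i') \<Rightarrow> \<lambda>j. (A i j, A' i' j)) j = (case r' of (i, i') \<Rightarrow> \<lambda>j. (A i j, A' i' j)) j"
    have "fst r = fst r'"
      using aoa_familyD(11)[OF m(1) C, of "fst r" "fst r'"] r e by (auto simp: case_prod_unfold)
    moreover have "snd r = snd r'"
      using aoa_familyD(11)[OF n(1) C, of "snd r" "snd r'"] r e by (auto simp: case_prod_unfold)
    ultimately show "r = r'" by (simp add: prod_eq_iff)
  next
    fix C r r'
    assume C: "C \<subseteq> {..<k}" "card C = s" and r: "r \<in> {..<m ^ t} \<times> {..<n ^ t}" "r' \<in> {..<m ^ t} \<times> {..<n ^ t}"
      and e: "(\<forall>j\<in>C. (case r of (i, i') \<Rightarrow> \<lambda>j. (A i j, A' i' j)) j = (case r' of (i, i') \<Rightarrow> \<lambda>j. (A i j, A' i' j)) j)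
        \<and> (case r of (i, i') \<Rightarrow> (L i, L' i')) = (case r' of (i, i') \<Rightarrow> (L i, L' i'))"
    have "fst r = fst r'"
      using aoa_familyD(12)[OF m(1) C, of "fst r" "fst r'"] r e by (auto simp: case_prod_unfold)
    moreover have "snd r = snd r'"
      using aoa_familyD(12)[OF n(1) C, of "snd r" "snd r'"] r e by (auto simp: case_prod_unfold)
    ultimately show "r = r'" by (simp add: prod_eq_iff)
  qed (use aoa_familyD(1-10)[OF m(1)] aoa_familyD(1-10)[OF n(1)] m(2) n(2) in \<open>auto simp: card_cartesian_product power_mult_distrib\<close>)
  from AOA_exists_if_aoa_family[OF this] show ?thesis
    using m n by (simp add: card_cartesian_product)
qed

section \<open>Arrays from orthogonal orthomorphisms\<close>

definition red :: "int \<Rightarrow> int \<Rightarrow> int \<times> int \<Rightarrow> int \<times> int" where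
  "red m n p = (fst p mod m, snd p mod n)"

definition residue_pairs :: "int \<Rightarrow> int \<Rightarrow> (int \<times> int) set" where
  "residue_pairs m n = {0..<m} \<times> {0..<n}"

text \<open>The maps \<open>f\<close> and \<open>g\<close> take representatives to arbitrary integer pairs; only their classes in
  \<open>\<int>\<^sub>m \<times> \<int>\<^sub>n\<close> matter.\<close>

definition orth :: "int \<Rightarrow> int \<Rightarrow> (int \<times> int \<Rightarrow> int \<times> int) \<Rightarrow> (int \<times> int \<Rightarrow> int \<times> int) \<Rightarrow> bool" where
  "orth m n f g \<longleftrightarrow> inj_on (\<lambda>s. red m n (f s - g s)) (residue_pairs m n)"

section \<open>Arithmetic of residue pairs\<close>

lemma red_diff:
  assumes "red m n p = red m n q" "red m n p' = red m n q'"
  shows "red m n (p - p') = red m n (q - q')"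
  using assms by (auto simp: red_def intro: mod_diff_cong)

lemma red_add_cancel:
  assumes "red m n (x + p) = red m n (x + q)"
  shows "red m n p = red m n q"
  using red_diff[OF assms refl[of "red m n x"]] by simp

lemma red_eq_self: "p \<in> residue_pairs m n \<Longrightarrow> red m n p = p"
  by (auto simp: red_def residue_pairs_def)

lemma red_in: "m > 0 \<Longrightarrow> n > 0 \<Longrightarrow> red m n p \<in> residue_pairs m n"
  by (auto simp: red_def residue_pairs_def)

lemma red_add_inj:
  assumes "red m n (x + p) = red m n (x + q)" "p \<in> residue_pairs m n" "q \<in> residue_pairs m n"
  shows "p = q"
  using red_add_cancel[OF assms(1)] assms(2,3) by (simp add: red_eq_self)

lemma three_subset_of_five:
  assumes "C \<subseteq> {..<5::nat}" "card C = 3"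
  shows "{0, 1, 2} \<subseteq> C \<or> {0, 1, 3} \<subseteq> C \<or> {0, 1, 4} \<subseteq> C \<or>
    {0, 2, 3} \<subseteq> C \<or> {0, 2, 4} \<subseteq> C \<or> {0, 3, 4} \<subseteq> C \<or>
    {1, 2, 3} \<subseteq> C \<or> {1, 2, 4} \<subseteq> C \<or> {1, 3, 4} \<subseteq> C \<or> {2, 3, 4} \<subseteq> C"
proof -
  obtain x y z where C: "C = {x, y, z}" and d: "x \<noteq> y" "y \<noteq> z" "x \<noteq> z"
    using assms(2) by (auto simp: card_3_iff)
  have "u = 0 \<or> u = 1 \<or> u = 2 \<or> u = 3 \<or> u = 4" if "u \<in> C" for u
    using that assms(1) by force
  then have "x = 0 \<or> x = 1 \<or> x = 2 \<or> x = 3 \<or> x = 4" "y = 0 \<or> y = 1 \<or> y = 2 \<or> y = 3 \<or> y = 4"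
    "z = 0 \<or> z = 1 \<or> z = 2 \<or> z = 3 \<or> z = 4"
    unfolding C by blast+
  then show ?thesis
    unfolding C using d by (elim disjE) simp_all
qed

text \<open>Differences of columns eliminate \<open>a\<close> and \<open>i\<close> and leave a
  difference of two of the maps \<open>0\<close>, \<open>id\<close>, \<open>\<alpha>\<close>,
  \<open>\<beta>\<close> at \<open>s\<close>, which is injective. With \<open>s\<close> known,
  \<open>a\<close> and \<open>i\<close> follow.\<close>

lemma AOA_exists_if_orth:
  assumes m: "m > 0" and n: "n > 0"
    and \<alpha>: "orth m n \<alpha> (\<lambda>_. 0)" "orth m n \<alpha> id"
    and \<beta>: "orth m n \<beta> (\<lambda>_. 0)" "orth m n \<beta> id"
    and \<alpha>\<beta>: "orth m n \<alpha> \<beta>"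
  shows "AOA_exists 1 3 5 (nat (m * n))"
proof -
  let ?X = "residue_pairs m n" and ?r = "red m n"
  let ?A = "\<lambda>(s, a, i) j. ?r ([a, s + a, \<alpha> s + (i + a), \<beta> s + (i + a), i] ! j)"
  let ?L = "\<lambda>(s, a, i). (s, ?r (i + \<alpha> a))"
  have cX: "card ?X = nat (m * n)" and fX: "finite ?X"
    using m n by (auto simp: residue_pairs_def card_cartesian_product nat_mult_distrib)
  have "aoa_family 1 3 5 ?X (?X \<times> ?X) (?X \<times> ?X \<times> ?X) ?A ?L"
    unfolding aoa_family_def
  proof (intro conjI ballI allI impI)
    fix C r r'
    assume C: "C \<subseteq> {..<5::nat}" "card C = 3" and r: "r \<in> ?X \<times> ?X \<times> ?X" and r': "r' \<in> ?X \<times> ?X \<times> ?X"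
      and eq: "\<forall>j\<in>C. ?A r j = ?A r' j"
    obtain s a i where r_eq: "r = (s, a, i)" and X: "s \<in> ?X" "a \<in> ?X" "i \<in> ?X" using r by auto
    obtain s' a' i' where r'_eq: "r' = (s', a', i')" and X': "s' \<in> ?X" "a' \<in> ?X" "i' \<in> ?X" using r' by auto
    have E: "0 \<in> C \<Longrightarrow> ?r a = ?r a'" "1 \<in> C \<Longrightarrow> ?r (s + a) = ?r (s' + a')"
      "2 \<in> C \<Longrightarrow> ?r (\<alpha> s + (i + a)) = ?r (\<alpha> s' + (i' + a'))"
      "3 \<in> C \<Longrightarrow> ?r (\<beta> s + (i + a)) = ?r (\<beta> s' + (i' + a'))"
      "4 \<in> C \<Longrightarrow> ?r i = ?r i'"
      using eq by (auto simp: r_eq r'_eq dest!: bspec)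
    have orthD: "s = s'" if "orth m n f g" "?r (f s - g s) = ?r (f s' - g s')" for f g
      using that X X' by (auto simp: orth_def dest: inj_onD)
    \<comment> \<open>A triple of columns containing neither \<open>{0, 1}\<close> nor
      \<open>{2, 3}\<close> consists of column 4 and one column of each pair, which gives four
      further cases.\<close>
    have "s = s'" if "2 \<in> C" "3 \<in> C"
      using red_diff[OF E(3) E(4)] that by (intro orthD[OF \<alpha>\<beta>]) simp
    moreover have "s = s'" if "0 \<in> C" "1 \<in> C"
      using red_diff[OF E(2) E(1)] that X X' by (simp add: red_eq_self)
    moreover have "s = s'" if "0 \<in> C" "4 \<in> C" "2 \<in> C"
      using red_diff[OF red_diff[OF E(3) E(5)] E(1)] that by (intro orthD[OF \<alpha>(1)]) simp
    moreover have "s = s'" if "0 \<in> C" "4 \<in> C" "3 \<in> C"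
      using red_diff[OF red_diff[OF E(4) E(5)] E(1)] that by (intro orthD[OF \<beta>(1)]) simp
    moreover have "s = s'" if "1 \<in> C" "4 \<in> C" "2 \<in> C"
      using red_diff[OF red_diff[OF E(3) E(5)] E(2)] that by (intro orthD[OF \<alpha>(2)]) simp
    moreover have "s = s'" if "1 \<in> C" "4 \<in> C" "3 \<in> C"
      using red_diff[OF red_diff[OF E(4) E(5)] E(2)] that by (intro orthD[OF \<beta>(2)]) simp
    ultimately have s: "s = s'"
      using three_subset_of_five[OF C] by auto
    have a: "a = a'" if "0 \<in> C \<or> 1 \<in> C"
      using that E(1,2) X X' red_add_inj[of m n s' a a'] by (auto simp: s red_eq_self)
    have i: "i = i'" if "4 \<in> C"
      using that E(5) X X' by (auto simp: red_eq_self)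
    have ia: "?r (i + a) = ?r (i' + a')" if "2 \<in> C \<or> 3 \<in> C"
      using that E(3,4) by (auto simp: s dest: red_add_cancel)
    have "a = a'" if "4 \<in> C" "2 \<in> C \<or> 3 \<in> C"
      using ia[OF that(2)] i[OF that(1)] X X' red_add_inj[of m n i a a'] by auto
    moreover have "i = i'" if "0 \<in> C \<or> 1 \<in> C" "2 \<in> C \<or> 3 \<in> C"
      using ia[OF that(2)] a[OF that(1)] X X' red_add_inj[of m n a i i']
      by (auto simp: add.commute)
    ultimately show "r = r'"
      using three_subset_of_five[OF C] a i s by (auto simp: r_eq r'_eq)
  next
    fix C r r'
    assume C: "C \<subseteq> {..<5::nat}" "card C = 1" and r: "r \<in> ?X \<times> ?X \<times> ?X" and r': "r' \<in> ?X \<times> ?X \<times> ?X"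
      and eq: "(\<forall>j\<in>C. ?A r j = ?A r' j) \<and> ?L r = ?L r'"
    obtain s a i where r_eq: "r = (s, a, i)" and X: "s \<in> ?X" "a \<in> ?X" "i \<in> ?X" using r by auto
    obtain s' a' i' where r'_eq: "r' = (s', a', i')" and X': "s' \<in> ?X" "a' \<in> ?X" "i' \<in> ?X" using r' by auto
    have s: "s = s'" and L: "?r (i + \<alpha> a) = ?r (i' + \<alpha> a')"
      using eq by (auto simp: r_eq r'_eq)
    have orthD: "a = a'" if "orth m n f g" "?r (f a - g a) = ?r (f a' - g a')" for f g
      using that X X' by (auto simp: orth_def dest: inj_onD)
    have i: "i = i'" if "a = a'"
      using L that X X' red_add_inj[of m n "\<alpha> a" i i'] by (auto simp: add.commute)
    obtain j where j: "C = {j}" using C(2) by (rule card_1_singletonE)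
    then consider "j = 0" | "j = 1" | "j = 2" | "j = 3" | "j = 4" using C(1) by force
    \<comment> \<open>The last column gives \<open>s\<close> and \<open>i + \<alpha> a\<close>.
      Columns 0 and 1 yield \<open>a\<close> directly, columns 2 and 3 yield \<open>i + a\<close>
      and hence \<open>\<alpha> a - a\<close>, and column 4 yields
      \<open>\<alpha> a\<close>.\<close>
    then have "a = a'"
    proof cases
      case 1
      then show ?thesis using eq j X X' by (auto simp: r_eq r'_eq red_eq_self)
    next
      case 2
      then have "?r (s + a) = ?r (s + a')" using eq j s by (auto simp: r_eq r'_eq)
      then show ?thesis using X X' red_add_inj by blast
    next
      case 3
      then have "?r (\<alpha> s + (i + a)) = ?r (\<alpha> s + (i' + a'))" using eq j s by (auto simp: r_eq r'_eq)
      from red_diff[OF L red_add_cancel[OF this]] show ?thesis by (intro orthD[OF \<alpha>(2)]) simp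
    next
      case 4
      then have "?r (\<beta> s + (i + a)) = ?r (\<beta> s + (i' + a'))" using eq j s by (auto simp: r_eq r'_eq)
      from red_diff[OF L red_add_cancel[OF this]] show ?thesis by (intro orthD[OF \<alpha>(2)]) simp
    next
      case 5
      then have "?r i = ?r i'" using eq j by (auto simp: r_eq r'_eq)
      from red_diff[OF L this] show ?thesis by (intro orthD[OF \<alpha>(1)]) simp
    qed
    then show "r = r'" using s i by (simp add: r_eq r'_eq)
  qed (use m n fX in \<open>auto simp: red_in card_cartesian_product power2_eq_square power3_eq_cube\<close>)
  from AOA_exists_if_aoa_family[OF this] show ?thesis by (simp add: cX)
qed

section \<open>Small orders\<close>

text \<open>Makes orthogonality of concrete maps checkable by evaluation.\<close>

lemma orth_iff_distinct:
  "orth m n f g \<longleftrightarrow> distinct (map (\<lambda>s. red m n (f s - g s)) (List.product [0..m - 1] [0..n - 1]))"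
proof -
  have "set (List.product [0..m - 1] [0..n - 1]) = residue_pairs m n"
    by (auto simp: residue_pairs_def)
  then show ?thesis
    by (simp add: orth_def distinct_map distinct_product)
qed

text \<open>The second modulus is \<open>n\<close>; values are listed in the order in which
  \<open>List.product\<close> runs through the pairs.\<close>

definition tab :: "int \<Rightarrow> (int \<times> int) list \<Rightarrow> int \<times> int \<Rightarrow> int \<times> int" where
  "tab n T s = T ! nat (fst s * n + snd s)"

lemma AOA_exists_4: "AOA_exists 1 3 5 4"
proof -
  \<comment> \<open>In the field of order 4 these are the multiplications by a primitive element and
    by its square; their differences are again multiplications by nonzero elements.\<close>
  have "AOA_exists 1 3 5 (nat (2 * 2))"
    by (rule AOA_exists_if_orth[where \<alpha> = "\<lambda>(x, y). (y, x + y)" and \<beta> = "\<lambda>(x, y). (x + y, x)"];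
        (unfold orth_iff_distinct)?, code_simp)
  then show ?thesis by simp
qed

lemma AOA_exists_9: "AOA_exists 1 3 5 9"
proof -
  \<comment> \<open>In the field of order 9, with \<open>(x, y)\<close> read as
    \<open>x + y i\<close> and \<open>i^2 = -1\<close>, these are the multiplications by
    \<open>i\<close> and \<open>1 + i\<close>.\<close>
  have "AOA_exists 1 3 5 (nat (3 * 3))"
    by (rule AOA_exists_if_orth[where \<alpha> = "\<lambda>(x, y). (- y, x)" and \<beta> = "\<lambda>(x, y). (x - y, x + y)"];
        (unfold orth_iff_distinct)?, code_simp)
  then show ?thesis by simp
qed

text \<open>The tables for orders 8, 12, 24 and 27 were found with a SAT solver.\<close>

lemma AOA_exists_8: "AOA_exists 1 3 5 8"
proof -
  \<comment> \<open>A cyclic group of even order has no orthomorphism, because its elements do not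
    sum to zero; hence a noncyclic group here and for orders 12 and 24.\<close>
  have "AOA_exists 1 3 5 (nat (2 * 4))"
    by (rule AOA_exists_if_orth[where
          \<alpha> = "tab 4 [(0, 0), (1, 1), (0, 1), (1, 0), (1, 2), (0, 3), (1, 3), (0, 2)]" and
          \<beta> = "tab 4 [(0, 0), (1, 0), (1, 3), (0, 1), (0, 2), (1, 2), (1, 1), (0, 3)]"];
        (unfold orth_iff_distinct)?, code_simp)
  then show ?thesis by simp
qed

lemma AOA_exists_12: "AOA_exists 1 3 5 12"
proof -
  have "AOA_exists 1 3 5 (nat (2 * 6))"
    by (rule AOA_exists_if_orth[where
          \<alpha> = "tab 6 [(0, 0), (1, 2), (0, 4), (1, 1), (1, 3), (0, 2), (1, 4), (1, 0), (0, 5), (0, 3), (1, 5), (0, 1)]" and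
          \<beta> = "tab 6 [(0, 0), (1, 4), (0, 1), (1, 2), (0, 5), (1, 3), (0, 2), (1, 5), (0, 3), (1, 0), (0, 4), (1, 1)]"];
        (unfold orth_iff_distinct)?, code_simp)
  then show ?thesis by simp
qed

lemma AOA_exists_24: "AOA_exists 1 3 5 24"
proof -
  have "AOA_exists 1 3 5 (nat (2 * 12))"
    by (rule AOA_exists_if_orth[where
          \<alpha> = "tab 12 [(0, 0), (1, 0), (1, 4), (0, 9), (1, 11), (0, 2), (1, 10), (0, 10), (0, 4), (1, 9), (1, 3), (0, 3),
             (1, 1), (0, 11), (1, 7), (1, 2), (0, 7), (0, 1), (1, 8), (0, 8), (1, 6), (0, 6), (1, 5), (0, 5)]" and
          \<beta> = "tab 12 [(0, 0), (0, 3), (0, 6), (1, 1), (0, 10), (0, 8), (1, 8), (1, 4), (0, 9), (1, 10), (1, 2), (1, 11),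
             (1, 5), (0, 7), (1, 9), (0, 11), (1, 0), (0, 4), (1, 3), (1, 6), (0, 1), (1, 7), (0, 5), (0, 2)]"];
        (unfold orth_iff_distinct)?, code_simp)
  then show ?thesis by simp
qed

lemma AOA_exists_27: "AOA_exists 1 3 5 27"
proof -
  have "AOA_exists 1 3 5 (nat (3 * 9))"
    by (rule AOA_exists_if_orth[where
          \<alpha> = "tab 9 [(0, 0), (0, 8), (0, 6), (2, 8), (2, 3), (1, 8), (2, 7), (2, 4), (0, 7), (2, 5), (2, 0), (1, 3),
             (0, 5), (2, 6), (1, 7), (2, 1), (1, 4), (1, 2), (1, 0), (1, 5), (0, 3), (0, 1), (0, 4), (0, 2),
             (2, 2), (1, 1), (1, 6)]" and
          \<beta> = "tab 9 [(0, 0), (2, 0), (1, 7), (2, 3), (2, 6), (0, 7), (1, 0), (1, 8), (0, 4), (1, 3), (0, 2), (0, 8),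
             (1, 2), (2, 4), (2, 2), (1, 4), (0, 1), (2, 7), (1, 5), (0, 5), (1, 6), (1, 1), (0, 6), (0, 3),
             (2, 1), (2, 8), (2, 5)]"];
        (unfold orth_iff_distinct)?, code_simp)
  then show ?thesis by simp
qed

section \<open>Orders $3w$ with $w$ coprime to 6\<close>

lemma mod_mult_cancel_coprime:
  fixes e w a b :: int
  assumes "coprime e w" "(e * a) mod w = (e * b) mod w"
  shows "a mod w = b mod w"
proof -
  have "w dvd e * (a - b)" using assms(2) by (simp add: mod_eq_dvd_iff algebra_simps)
  then have "w dvd a - b" using assms(1) by (simp add: coprime_commute coprime_dvd_mult_right_iff)
  then show ?thesis by (simp add: mod_eq_dvd_iff)
qed

text \<open>The condition on the three values for fixed \<open>y\<close> is the one that remains once the second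
  component of the difference has been prescribed: it determines \<open>x + p a\<close>.\<close>

lemma orth_if_shifted:
  fixes w e :: int and p :: "int \<Rightarrow> int" and G :: "int \<Rightarrow> int \<Rightarrow> int"
  assumes diff: "\<And>a x. a \<in> {0..<3} \<Longrightarrow> f (a, x) - g (a, x) = (G a x, e * (x + p a))"
    and e: "coprime e w"
    and per: "\<And>a x. G a (x mod w) = G a x"
    and distinct: "\<And>y. distinct [G 0 (y - p 0) mod 3, G 1 (y - p 1) mod 3, G 2 (y - p 2) mod 3]"
  shows "orth 3 w f g"
  unfolding orth_def
proof (rule inj_onI)
  fix s s' assume s: "s \<in> residue_pairs 3 w" and s': "s' \<in> residue_pairs 3 w"
    and eq: "red 3 w (f s - g s) = red 3 w (f s' - g s')"
  obtain a x where ax: "s = (a, x)" "a \<in> {0..<3}" "x \<in> {0..<w}"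
    using s by (auto simp: residue_pairs_def)
  obtain a' x' where ax': "s' = (a', x')" "a' \<in> {0..<3}" "x' \<in> {0..<w}"
    using s' by (auto simp: residue_pairs_def)
  have G: "G a x mod 3 = G a' x' mod 3" and "(e * (x + p a)) mod w = (e * (x' + p a')) mod w"
    using eq unfolding ax(1) ax'(1) diff[OF ax(2)] diff[OF ax'(2)] by (simp_all add: red_def)
  then have x: "(x + p a) mod w = (x' + p a') mod w"
    using mod_mult_cancel_coprime[OF e] by blast
  define y where "y = x + p a"
  \<comment> \<open>\<open>x'\<close> and \<open>y - p a'\<close> agree only modulo
    \<open>w\<close>; the periodicity of \<open>G\<close> bridges the gap.\<close>
  have "x' mod w = (y - p a') mod w"
    using mod_diff_cong[OF x refl[of "p a' mod w"]] by (simp add: y_def)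
  then have "G a' x' = G a' (y - p a')" by (metis per)
  then have "G a (y - p a) mod 3 = G a' (y - p a') mod 3" using G by (simp add: y_def)
  moreover have "a = 0 \<or> a = 1 \<or> a = 2" "a' = 0 \<or> a' = 1 \<or> a' = 2" using ax ax' by auto
  ultimately have a: "a = a'" using distinct[of y] by auto
  have "x mod w = x' mod w"
    using mod_diff_cong[OF x refl[of "p a mod w"]] by (simp add: a)
  then show "s = s'" using ax ax' a by simp
qed

text \<open>A letter at position \<open>x\<close> of the cyclic word lists the values \<open>B 0 x\<close>, \<open>B 1 x\<close>, \<open>B 2 x\<close> and
  \<open>c x\<close> of the header. The three conditions say that \<open>\<beta>\<close> is orthogonal to zero, to the identity
  and to \<open>\<alpha>\<close>.\<close>

definition ok_window :: "int list \<Rightarrow> int list \<Rightarrow> int list \<Rightarrow> int list \<Rightarrow> int list \<Rightarrow> bool" where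
  "ok_window l0 l1 l2 l3 l4 \<longleftrightarrow>
     distinct [l2 ! 0 mod 3, l0 ! 1 mod 3, l4 ! 2 mod 3] \<and>
     distinct [l2 ! 0 mod 3, (l1 ! 1 - 1) mod 3, (l3 ! 2 - 2) mod 3] \<and>
     distinct [(l2 ! 3 - l2 ! 0) mod 3, (l3 ! 3 - 1 - l3 ! 1) mod 3, (l1 ! 3 - 2 - l1 ! 2) mod 3]"

text \<open>The five differences have slopes -3, -4, -1, -2, -2, all units modulo \<open>w\<close>.
  Those involving \<open>\<beta>\<close> have shifts \<open>2 * t a\<close>, \<open>t a\<close> and
  \<open>- t a\<close>, so they compare letters at distance at most 2 from \<open>y\<close>.\<close>

lemma AOA_exists_if_ok_windows:
  fixes w :: nat and W :: "int \<Rightarrow> int list"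
  assumes w: "coprime w 6" "w > 0"
    and per: "\<And>x. W (x mod int w) = W x"
    and ok: "\<And>y. ok_window (W (y - 2)) (W (y - 1)) (W y) (W (y + 1)) (W (y + 2))"
  shows "AOA_exists 1 3 5 (3 * w)"
proof -
  define t :: "int \<Rightarrow> int" where "t a = (if a = 0 then 0 else if a = 1 then 1 else - 1)" for a
  define \<alpha> where "\<alpha> = (\<lambda>(a, x). (W x ! 3 - a, - 3 * x))"
  define \<beta> where "\<beta> = (\<lambda>(a, x). (W x ! nat a, - x - 2 * t a))"
  have "coprime w 2" "coprime w 3"
    using w(1) coprime_mult_right_iff[of w 2 3] by simp_all
  then have "coprime (int w) 2" "coprime (int w) 3"
    by (metis coprime_int_iff of_nat_numeral)+
  then have c: "coprime (- 2) (int w)" "coprime (- 3) (int w)" "coprime (- 4) (int w)"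
    using coprime_mult_right_iff[of "int w" 2 2] by (simp_all add: coprime_commute)
  have "AOA_exists 1 3 5 (nat (3 * int w))"
  proof (rule AOA_exists_if_orth[where \<alpha> = \<alpha> and \<beta> = \<beta>])
    \<comment> \<open>For the two differences without \<open>\<beta>\<close> the word is
      unconstrained: \<open>- a\<close> and \<open>- 2 * a\<close> run through all residues modulo
      3.\<close>
    show "orth 3 (int w) \<alpha> (\<lambda>_. 0)"
      by (rule orth_if_shifted[where e = "- 3" and p = "\<lambda>_. 0" and G = "\<lambda>a x. W x ! 3 - a"])
        (use c per in \<open>auto simp: \<alpha>_def zero_prod_def mod_eq_dvd_iff\<close>)
    show "orth 3 (int w) \<alpha> id"
      by (rule orth_if_shifted[where e = "- 4" and p = "\<lambda>_. 0" and G = "\<lambda>a x. W x ! 3 - 2 * a"])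
        (use c per in \<open>auto simp: \<alpha>_def mod_eq_dvd_iff\<close>)
    show "orth 3 (int w) \<beta> (\<lambda>_. 0)"
      by (rule orth_if_shifted[where e = "- 1" and p = "\<lambda>a. 2 * t a" and G = "\<lambda>a x. W x ! nat a"])
        (use per ok in \<open>auto simp: \<beta>_def t_def zero_prod_def ok_window_def\<close>)
    show "orth 3 (int w) \<beta> id"
      by (rule orth_if_shifted[where e = "- 2" and p = t and G = "\<lambda>a x. W x ! nat a - a"])
        (use c per ok in \<open>auto simp: \<beta>_def t_def ok_window_def\<close>)
    show "orth 3 (int w) \<alpha> \<beta>"
      by (rule orth_if_shifted[where e = "- 2" and p = "\<lambda>a. - t a" and G = "\<lambda>a x. W x ! 3 - a - W x ! nat a"])
        (use c per ok in \<open>auto simp: \<alpha>_def \<beta>_def t_def ok_window_def\<close>)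
  qed (use w in auto)
  then show ?thesis by (simp add: nat_mult_distrib)
qed

text \<open>The word consists of a defect \<open>U\<close> followed by a block of period 3. The block alone is a valid
  cyclic word, but only of lengths divisible by 3; the defect corrects the length modulo 3.\<close>

definition letter :: "int list list \<Rightarrow> nat \<Rightarrow> int list" where
  "letter U x = (if x < length U then U ! x
     else [[2,1,0,0],[1,0,2,0],[0,2,1,0]] ! ((x - length U) mod 3))"

text \<open>The window is indexed by its start and positions are natural numbers, so that a concrete
  word can be checked by evaluation.\<close>

definition ok_at :: "int list list \<Rightarrow> nat \<Rightarrow> nat \<Rightarrow> bool" where
  "ok_at U w q \<longleftrightarrow> ok_window (letter U q) (letter U ((q + 1) mod w)) (letter U ((q + 2) mod w))
     (letter U ((q + 3) mod w)) (letter U ((q + 4) mod w))"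

lemma AOA_exists_if_ok_at:
  assumes w: "coprime w 6" "w > 0" and ok: "\<And>q. q < w \<Longrightarrow> ok_at U w q"
  shows "AOA_exists 1 3 5 (3 * w)"
proof (rule AOA_exists_if_ok_windows[OF w, where W = "\<lambda>x. letter U (nat (x mod int w))"])
  fix y :: int
  \<comment> \<open>The window centred at \<open>y\<close> starts two positions earlier.\<close>
  define q where "q = nat ((y - 2) mod int w)"
  have q: "int q = (y - 2) mod int w" "q < w" using w(2) by (simp_all add: q_def nat_less_iff)
  have "(q + d) mod w = nat ((y - 2 + int d) mod int w)" for d
    by (metis nat_int of_nat_add of_nat_mod q(1) mod_add_left_eq)
  from this[of 1] this[of 2] this[of 3] this[of 4] ok[OF q(2)]
  show "ok_window (letter U (nat ((y - 2) mod int w))) (letter U (nat ((y - 1) mod int w)))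
    (letter U (nat (y mod int w))) (letter U (nat ((y + 1) mod int w))) (letter U (nat ((y + 2) mod int w)))"
    by (simp add: ok_at_def q_def[symmetric] algebra_simps)
qed simp

section \<open>Reduction of all word lengths to finitely many\<close>

lemma letter_add_3_mult:
  assumes "length U \<le> x"
  shows "letter U (x + 3 * j) = letter U x"
proof -
  have "x + 3 * j - length U = x - length U + 3 * j" using assms by simp
  then have "(x + 3 * j - length U) mod 3 = (x - length U) mod 3" by (metis mod_mult_self2)
  then show ?thesis using assms by (simp add: letter_def)
qed

text \<open>With at least three blocks, every window of the long word already occurs in the word
  with exactly three: windows starting in the defect stay in place, the others move left by a
  multiple of 3.\<close>

lemma ok_at_pump:
  assumes ok: "\<And>q. q < length U + 9 \<Longrightarrow> ok_at U (length U + 9) q"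
    and k: "k \<ge> 3" and q: "q < length U + 3 * k"
  shows "ok_at U (length U + 3 * k) q"
proof -
  let ?N = "length U" and ?w = "length U + 3 * k"
  have "\<exists>p < ?N + 9. \<forall>d\<le>4. letter U ((q + d) mod ?w) = letter U ((p + d) mod (?N + 9))"
  proof -
    consider "q < ?N" | "q \<ge> ?N" "q + 4 < ?w" | "q + 4 \<ge> ?w" by linarith
    then show ?thesis
    proof cases
      case 1
      then show ?thesis using k by (intro exI[of _ q]) auto
    next
      case 2
      \<comment> \<open>The first position after the defect with the same phase; a window from there
        does not wrap around.\<close>
      define p where "p = ?N + (q - ?N) mod 3"
      have p: "?N \<le> p" "p < ?N + 3" by (simp_all add: p_def)
      have "q = p + 3 * ((q - ?N) div 3)" using 2 by (simp add: p_def)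
      then obtain j where j: "q = p + 3 * j" by blast
      have "letter U ((q + d) mod ?w) = letter U ((p + d) mod (?N + 9))" if "d \<le> 4" for d
        using letter_add_3_mult[of U "p + d" j] p 2 that by (simp add: j add_ac)
      then show ?thesis using p by (intro exI[of _ p]) simp
    next
      case 3
      obtain j where j: "k = 3 + j" using k le_Suc_ex by blast
      \<comment> \<open>This keeps the distance to the end of the word, so both windows wrap around
        at the same offset.\<close>
      define p where "p = q - 3 * j"
      have qp: "q = p + 3 * j" and p: "?N + 5 \<le> p" "p < ?N + 9"
        using 3 q j by (simp_all add: p_def)
      have "letter U ((q + d) mod ?w) = letter U ((p + d) mod (?N + 9))" if "d \<le> 4" for d
      proof (cases "p + d < ?N + 9")
        case True
        then show ?thesis using letter_add_3_mult[of U "p + d" j] p by (simp add: qp j add_ac)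
      next
        case False
        then obtain c where c: "p + d = ?N + 9 + c" by (metis le_Suc_ex not_less)
        then have "q + d = ?w + c" "c < 4" using p that by (simp_all add: qp j)
        then show ?thesis using c k by simp
      qed
      then show ?thesis using p by (intro exI[of _ p]) simp
    qed
  qed
  then obtain p where p: "p < ?N + 9"
    and eq: "\<And>d. d \<le> 4 \<Longrightarrow> letter U ((q + d) mod ?w) = letter U ((p + d) mod (?N + 9))" by blast
  show ?thesis
    using ok[OF p] eq[of 0] eq[of 1] eq[of 2] eq[of 3] eq[of 4] p q by (simp add: ok_at_def)
qed

text \<open>Pumping starts from three blocks, so words with fewer blocks are checked
  separately.\<close>

lemma ok_at_all:
  assumes "length U = N"
    and small: "list_all (ok_at U N) [0..<N]" "list_all (ok_at U (N + 3)) [0..<N + 3]"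
      "list_all (ok_at U (N + 6)) [0..<N + 6]" "list_all (ok_at U (N + 9)) [0..<N + 9]"
    and q: "q < N + 3 * k"
  shows "ok_at U (N + 3 * k) q"
proof -
  consider "k = 0" | "k = 1" | "k = 2" | "k \<ge> 3" by linarith
  then show ?thesis
  proof cases
    case 4
    then show ?thesis
      using ok_at_pump[of U k q] small(4) q by (simp add: list_all_iff assms(1))
  qed (use small q in \<open>simp_all add: list_all_iff\<close>)
qed

text \<open>Both defects were found with a SAT solver and a backtracking search.\<close>

definition defect4 :: "int list list" where
  "defect4 = [[2,1,0,0],[1,1,2,1],[2,0,1,0],[0,2,0,2]]"

definition defect5 :: "int list list" where
  "defect5 = [[2,1,0,0],[1,1,2,1],[2,1,1,1],[2,0,0,2],[0,2,0,2]]"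

lemma ok_at_defect4: "q < 4 + 3 * k \<Longrightarrow> ok_at defect4 (4 + 3 * k) q"
  by (rule ok_at_all) (simp_all add: upt_rec ok_at_def ok_window_def letter_def defect4_def)

lemma ok_at_defect5: "q < 5 + 3 * k \<Longrightarrow> ok_at defect5 (5 + 3 * k) q"
  by (rule ok_at_all) (simp_all add: upt_rec ok_at_def ok_window_def letter_def defect5_def)

lemma AOA_exists_3_mult:
  assumes "coprime w 6" "w \<ge> 5"
  shows "AOA_exists 1 3 5 (3 * w)"
proof -
  have "\<not> 3 dvd w"
  proof
    assume "3 dvd w"
    from coprime_common_divisor[OF assms(1) this] show False by simp
  qed
  then have "w mod 3 \<noteq> 0" by (simp add: dvd_eq_mod_eq_0)
  then have "w mod 3 = 1 \<or> w mod 3 = 2" using mod_less_divisor[of 3 w] by linarith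
  then show ?thesis
  proof
    assume "w mod 3 = 1"
    \<comment> \<open>The subtraction is not truncated, as \<open>w \<ge> 5\<close>. The residue of
      \<open>w\<close> modulo 3 selects the defect.\<close>
    then have "w = 4 + 3 * (w div 3 - 1)" using assms(2) div_mult_mod_eq[of w 3] by linarith
    then obtain k where "w = 4 + 3 * k" by blast
    then have "ok_at defect4 w q" if "q < w" for q
      using ok_at_defect4[of q k] that by simp
    then show ?thesis using assms by (intro AOA_exists_if_ok_at[of w defect4]) simp_all
  next
    assume "w mod 3 = 2"
    then have "w = 5 + 3 * (w div 3 - 1)" using assms(2) div_mult_mod_eq[of w 3] by linarith
    then obtain k where "w = 5 + 3 * k" by blast
    then have "ok_at defect5 w q" if "q < w" for q
      using ok_at_defect5[of q k] that by simp
    then show ?thesis using assms by (intro AOA_exists_if_ok_at[of w defect5]) simp_all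
  qed
qed

section \<open>Assembling the orders\<close>

text \<open>The cyclic group is encoded with a trivial first component. The five differences have
  slopes 2, 1, 3, 2, -1, all units. The case \<open>w = 1\<close> supplies the trivial order
  1.\<close>

lemma AOA_exists_coprime_6:
  assumes "coprime w 6" "w > 0"
  shows "AOA_exists 1 3 5 w"
proof -
  have "coprime w 2" "coprime w 3"
    using assms(1) coprime_mult_right_iff[of w 2 3] by simp_all
  then have "coprime (int w) 2" "coprime (int w) 3"
    by (metis coprime_int_iff of_nat_numeral)+
  then have c: "coprime 2 (int w)" "coprime 3 (int w)"
    by (simp_all add: coprime_commute)
  have orth: "orth 1 (int w) f g"
    if diff: "\<And>y. f (0, y) - g (0, y) = (0, e * y)" and e: "coprime e (int w)" for f g and e :: int
    unfolding orth_def
  proof (rule inj_onI)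
    fix s s' assume s: "s \<in> residue_pairs 1 (int w)" "s' \<in> residue_pairs 1 (int w)"
      and eq: "red 1 (int w) (f s - g s) = red 1 (int w) (f s' - g s')"
    obtain x y where xy: "s = (0, x)" "s' = (0, y)" "x \<in> {0..<int w}" "y \<in> {0..<int w}"
      using s by (auto simp: residue_pairs_def)
    have "(e * x) mod int w = (e * y) mod int w"
      using eq unfolding xy(1,2) diff by (simp add: red_def)
    from mod_mult_cancel_coprime[OF e this] show "s = s'" using xy by simp
  qed
  have "AOA_exists 1 3 5 (nat (1 * int w))"
  proof (rule AOA_exists_if_orth[where \<alpha> = "\<lambda>(a, x). (0, 2 * x)" and \<beta> = "\<lambda>(a, x). (0, 3 * x)"])
    show "orth 1 (int w) (\<lambda>(a, x). (0, 2 * x)) (\<lambda>_. 0)"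
      using c by (intro orth[where e = 2]) (auto simp: zero_prod_def)
    show "orth 1 (int w) (\<lambda>(a, x). (0, 2 * x)) id"
      by (intro orth[where e = 1]) auto
    show "orth 1 (int w) (\<lambda>(a, x). (0, 3 * x)) (\<lambda>_. 0)"
      using c by (intro orth[where e = 3]) (auto simp: zero_prod_def)
    show "orth 1 (int w) (\<lambda>(a, x). (0, 3 * x)) id"
      using c by (intro orth[where e = 2]) auto
    show "orth 1 (int w) (\<lambda>(a, x). (0, 2 * x)) (\<lambda>(a, x). (0, 3 * x))"
      by (intro orth[where e = "- 1"]) auto
  qed (use assms in auto)
  then show ?thesis by simp
qed

text \<open>Every exponent other than 1 is a sum of twos and threes.\<close>

lemma AOA_exists_power:
  assumes n: "AOA_exists 1 3 5 (n ^ 2)" "AOA_exists 1 3 5 (n ^ 3)" and "k \<noteq> 1"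
  shows "AOA_exists 1 3 5 (n ^ k)"
  using \<open>k \<noteq> 1\<close>
proof (induction k rule: less_induct)
  case (less k)
  consider "k = 0" | "k = 2" | "k = 3" | "k \<ge> 4" using less.prems by linarith
  then show ?case
  proof cases
    case 1
    then show ?thesis using AOA_exists_coprime_6[of 1] by simp
  next
    case 4
    then have "AOA_exists 1 3 5 (n ^ (k - 2))" by (intro less.IH) auto
    from AOA_exists_mult[OF n(1) this] have "AOA_exists 1 3 5 (n ^ (2 + (k - 2)))"
      by (simp only: power_add)
    moreover have "2 + (k - 2) = k" using 4 by simp
    ultimately show ?thesis by (simp only:)
  qed (use n in auto)
qed

theorem theorem2p11:
  fixes v :: nat
  assumes "v \<ge> 4" and "v mod 4 \<noteq> 2"
  shows "AOA_exists 1 3 5 v"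
proof -
  obtain a u where a: "v = 2 ^ a * u" "\<not> 2 dvd u"
    by (rule multiplicity_decompose'[of v 2]) (use assms(1) in auto)
  obtain b w where b: "u = 3 ^ b * w" "\<not> 3 dvd w"
    by (rule multiplicity_decompose'[of u 3]) (use a assms(1) in \<open>auto intro: Nat.gr0I\<close>)
  have v: "v = 2 ^ a * 3 ^ b * w" using a b by simp
  have "\<not> 2 dvd w" using a b by auto
  then have "coprime w 2" "coprime w 3"
    using b(2) prime_imp_coprime[of 2 w] prime_imp_coprime[of 3 w] by (simp_all add: coprime_commute)
  then have w: "coprime w 6" "w > 0"
    using coprime_mult_right_iff[of w 2 3] \<open>\<not> 2 dvd w\<close> by (auto intro: Nat.gr0I)
  have "a \<noteq> 1"
  proof
    assume "a = 1"
    obtain c where "u = 2 * c + 1" using a(2) by (rule oddE)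
    then have "v = 2 + 4 * c" using a(1) \<open>a = 1\<close> by simp
    then have "v mod 4 = 2" by (simp only: mod_mult_self2) simp
    then show False using assms(2) by simp
  qed
  have pow2: "AOA_exists 1 3 5 (2 ^ k)" if "k \<noteq> 1" for k
    using AOA_exists_power[of 2 k] AOA_exists_4 AOA_exists_8 that by simp
  have pow3: "AOA_exists 1 3 5 (3 ^ k)" if "k \<noteq> 1" for k
    using AOA_exists_power[of 3 k] AOA_exists_9 AOA_exists_27 that by simp
  note w' = AOA_exists_coprime_6[OF w]
  show ?thesis
  proof (cases "b = 1")
    case False
    then show ?thesis unfolding v using \<open>a \<noteq> 1\<close> by (intro AOA_exists_mult pow2 pow3 w')
  next
    case b1: True
    \<comment> \<open>\<open>pow3\<close> does not cover a single factor 3, so it is joined with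
      \<open>w\<close> if \<open>a = 0\<close> and with a factor 4 otherwise. For
      \<open>a = 3\<close>, taking out 12 would leave a single factor 2, so 24 is taken out
      instead.\<close>
    consider "a = 0" | "a = 2" | "a = 3" | "a \<ge> 4" using \<open>a \<noteq> 1\<close> by linarith
    then show ?thesis
    proof cases
      case 1
      then have v3: "v = 3 * w" using v b1 by simp
      then have "w \<ge> 2" using assms(1) by linarith
      moreover have "w \<noteq> 2" "w \<noteq> 3" "w \<noteq> 4" using b(2) \<open>\<not> 2 dvd w\<close> by auto
      ultimately have "w \<ge> 5" by linarith
      then show ?thesis unfolding v3 by (rule AOA_exists_3_mult[OF w(1)])
    next
      case 2
      then have "v = 12 * w" using v b1 by simp
      then show ?thesis using AOA_exists_mult[OF AOA_exists_12 w'] by (simp only:)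
    next
      case 3
      then have "v = 24 * w" using v b1 by simp
      then show ?thesis using AOA_exists_mult[OF AOA_exists_24 w'] by (simp only:)
    next
      case 4
      then obtain c where c: "a = 2 + c" using le_Suc_ex[of 2 a] by auto
      then have v12: "v = 12 * (2 ^ (a - 2) * w)" using v b1 by (simp add: power_add)
      have "a - 2 \<noteq> 1" using 4 by simp
      then show ?thesis unfolding v12 by (intro AOA_exists_mult AOA_exists_12 pow2 w')
    qed
  qed
qed

end
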